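(* Let $\mathbf n=(n_k)_{k\ge1}$ and $\mathbf s=(s_k)_{k\ge1}$ be strictly increasing sequences of positive integers, and suppose that $\mathbf s$ has arbitrarily large quotient gaps, i.e. $\sup_k s_{k+1}/s_k=\infty$. Then there exists a Banach space $\mathbb X$ with a Schauder and $\mathbf n$-Schauder basis $\mathcal B$ such that $\mathcal B$ is $\mathbf s$-($\mathbf n$, strong partially greedy) but is neither ($\mathbf n$, conservative) nor quasi-greedy.
   Context: Banach spaces are separable, infinite-dimensional, over $\mathbb F=\mathbb R$ or $\mathbb C$; $\mathbb N=\{1,2,\dots\}$. A basis of $X$ is a sequence $\mathcal B=(e_n)_{n\ge1}\subset X$ whose linear span is norm-dense and for which there is a sequence $(e_n^* )_{n\ge1}\subset X^*$ with $e_j^*(e_k)=\delta_{j,k}$ and $0<\inf_n\{\|e_n\|,\|e_n^*\|\}\le\sup_n\{\|e_n\|,\|e_n^*\|\}<\infty$. It is Markushevich if moreover the span of $(e_n^* )$ is weak$^*$-dense in $X^*$; it is Schauder if it is Markushevich and there is $K$ with $\|\sum_{n=1}^me_n^*(x)e_n\|\le K\|x\|$ for all $x\in X$, $m\in\mathbb N$. Sequences are identified with their sets of terms. Put $P^{\mathbf n}_0(x)=0$, $P^{\mathbf n}_k(x)=\sum_{i=1}^k e_{n_i}^*(x)e_{n_i}$. $\mathcal B$ is $\mathbf n$-Schauder if there is $C>0$ with $\|P^{\mathbf n}_m(x)\|\le C\|x\|$ for all $x\in X$, $m\in\mathbb N$. For finite $A\subset\mathbb N$, $P_A(x)=\sum_{n\in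 A}e_n^*(x)e_n$ and $1_A=\sum_{n\in A}e_n$. For $x\in X$, $m\in\mathbb N$, a greedy set of $x$ of order $m$ is a set $A\subset\mathbb N$ with $|A|=m$ and $\min_{n\in A}|e_n^*(x)|\ge\max_{n\notin A}|e_n^*(x)|$; $G_m(x)$ denotes $P_A(x)$ for such an $A$ (not necessarily unique). Put $\widehat\sigma^{\mathbf n}_m(x)=\min_{0\le k\le m}\|x-P^{\mathbf n}_k(x)\|$. $\mathcal B$ is $\mathbf s$-($\mathbf n$, strong partially greedy) if there is $C\ge1$ with $\|x-G_m(x)\|\le C\,\widehat\sigma^{\mathbf n}_m(x)$ for all $x\in X$, all $m\in\mathbf s$ and all choices of $G_m(x)$. $\mathcal B$ is quasi-greedy if there is $C>0$ with $\|G_m(x)\|\le C\|x\|$ for all $x\in X$, all $m\in\mathbb N$ and all choices of $G_m(x)$. $\mathcal B$ is ($\mathbf n$, conservative) if there is $C>0$ with $\|1_A\|\le C\|1_B\|$ for all finite sets $A\subset\mathbf n$, $B\subset\mathbb N$ with $|A|\le|B|$ and $a<b$ for all $a\in A$, $b\in B\cap\mathbf n$. *)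

theory Defs
  imports "HOL-Analysis.Analysis" "HOL-Library.Function_Algebras"
begin

text \<open>
  Conventions. Sequences are indexed by the positive integers: only the values at indices
  \<open>k \<ge> 1\<close> of a function on \<^typ>\<open>nat\<close> are used.

  The scalar field is a type of class \<^class>\<open>real_normed_field\<close> and
  \<^class>\<open>euclidean_space\<close>. Both \<^typ>\<open>real\<close> and \<^typ>\<open>complex\<close>
  are instances, and by Frobenius' theorem they are the only ones up to isometric isomorphism.

  A Banach space is given by a carrier \<open>V\<close> and a norm \<open>N\<close> inside an ambient vector space, so
  that it can be quantified over existentially.
\<close>

locale normed_on = vector_space scale
  for scale :: "'f::{real_normed_field,euclidean_space} \<Rightarrow> 'v::ab_group_add \<Rightarrow> 'v" +
  fixes V :: "'v set" and N :: "'v \<Rightarrow> real"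
  assumes subspace_V: "subspace V"
    and N_nonneg: "x \<in> V \<Longrightarrow> 0 \<le> N x"
    and N_eq_0: "x \<in> V \<Longrightarrow> N x = 0 \<longleftrightarrow> x = 0"
    and N_triangle: "x \<in> V \<Longrightarrow> y \<in> V \<Longrightarrow> N (x + y) \<le> N x + N y"
    and N_scale: "x \<in> V \<Longrightarrow> N (scale c x) = norm c * N x"
begin

lemma N_diff_commute:
  assumes "x \<in> V" "y \<in> V" shows "N (x - y) = N (y - x)"
proof -
  have "x - y = scale (-1) (y - x)" by simp
  then show ?thesis
    using N_scale[of "y - x" "-1"] subspace_diff[OF subspace_V] assms by simp
qed

text \<open>
  \<^locale>\<open>Metric_space\<close> requires a distance that is nonnegative and symmetric also outside the
  carrier, where nothing is known about \<open>N\<close>; hence the case distinction.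
\<close>

sublocale Metric_space V "\<lambda>x y. if x \<in> V \<and> y \<in> V then N (x - y) else 0"
proof
  fix x y
  show "0 \<le> (if x \<in> V \<and> y \<in> V then N (x - y) else 0)"
    using N_nonneg subspace_diff[OF subspace_V] by simp
  show "(if x \<in> V \<and> y \<in> V then N (x - y) else 0) = (if y \<in> V \<and> x \<in> V then N (y - x) else 0)"
    using N_diff_commute by simp
next
  fix x y assume "x \<in> V" "y \<in> V"
  then show "(if x \<in> V \<and> y \<in> V then N (x - y) else 0) = 0 \<longleftrightarrow> x = y"
    using N_eq_0[of "x - y"] subspace_diff[OF subspace_V] by simp
next
  fix x y z assume "x \<in> V" "y \<in> V" "z \<in> V"
  then show "(if x \<in> V \<and> z \<in> V then N (x - z) else 0)
    \<le> (if x \<in> V \<and> y \<in> V then N (x - y) else 0) + (if y \<in> V \<and> z \<in> V then N (y - z) else 0)"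
    using N_triangle[of "x - y" "y - z"] subspace_diff[OF subspace_V] by simp
qed

text \<open>
  Functionals on \<open>V\<close> are undefined outside \<open>V\<close>, so that each is a single function and
  the topology of pointwise convergence on \<open>V\<close> is a product topology.
\<close>

definition dual :: "('v \<Rightarrow> 'f) set" where
  "dual = {f \<in> extensional V.
     (\<forall>x\<in>V. \<forall>y\<in>V. f (x + y) = f x + f y) \<and>
     (\<forall>c. \<forall>x\<in>V. f (scale c x) = c * f x) \<and>
     (\<exists>C. \<forall>x\<in>V. norm (f x) \<le> C * N x)}"

definition dual_norm :: "('v \<Rightarrow> 'f) \<Rightarrow> real" where
  "dual_norm f = (SUP x\<in>{x \<in> V. N x \<le> 1}. norm (f x))"

definition weak_star :: "('v \<Rightarrow> 'f) topology" where
  "weak_star = subtopology (product_topology (\<lambda>_. euclidean) V) dual"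

end

locale banach_on = normed_on +
  assumes complete: "mcomplete"
    and separable: "\<exists>D. countable D \<and> D \<subseteq> V \<and> mtopology closure_of D = V"
    and infinite_dimensional: "\<And>B. finite B \<Longrightarrow> span B \<noteq> V"

text \<open>
  \<open>es\<close> is the sequence of coordinate functionals; it is determined by \<open>e\<close>, since
  the span of \<open>e\<close> is dense.
\<close>

locale basis_on = banach_on scale V N
  for scale :: "'f::{real_normed_field,euclidean_space} \<Rightarrow> 'v::ab_group_add \<Rightarrow> 'v"
    and V :: "'v set" and N :: "'v \<Rightarrow> real" +
  fixes e :: "nat \<Rightarrow> 'v" and es :: "nat \<Rightarrow> 'v \<Rightarrow> 'f"
  assumes e_in: "n \<ge> 1 \<Longrightarrow> e n \<in> V"
    and es_in: "n \<ge> 1 \<Longrightarrow> es n \<in> dual"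
    and dense_span: "mtopology closure_of (span (e ` {1..})) = V"
    and biorthogonal: "j \<ge> 1 \<Longrightarrow> k \<ge> 1 \<Longrightarrow> es j (e k) = (if j = k then 1 else 0)"
    and seminormalized: "\<exists>a b. 0 < a \<and>
      (\<forall>n\<ge>1. a \<le> N (e n) \<and> a \<le> dual_norm (es n) \<and> N (e n) \<le> b \<and> dual_norm (es n) \<le> b)"
begin

definition markushevich :: bool where
  "markushevich \<longleftrightarrow>
     weak_star closure_of
       {(\<lambda>x\<in>V. \<Sum>n\<in>A. c n * es n x) | A c. finite A \<and> A \<subseteq> {1..}} = dual"

definition proj :: "nat set \<Rightarrow> 'v \<Rightarrow> 'v" where
  "proj A x = (\<Sum>n\<in>A. scale (es n x) (e n))"

definition partial_sum :: "(nat \<Rightarrow> nat) \<Rightarrow> nat \<Rightarrow> 'v \<Rightarrow> 'v" where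
  "partial_sum ns k x = (\<Sum>i=1..k. scale (es (ns i) x) (e (ns i)))"

definition schauder :: bool where
  "schauder \<longleftrightarrow> markushevich \<and>
     (\<exists>K. \<forall>x\<in>V. \<forall>m\<ge>1. N (\<Sum>n=1..m. scale (es n x) (e n)) \<le> K * N x)"

definition schauder_along :: "(nat \<Rightarrow> nat) \<Rightarrow> bool" where
  "schauder_along ns \<longleftrightarrow> (\<exists>C>0. \<forall>x\<in>V. \<forall>m\<ge>1. N (partial_sum ns m x) \<le> C * N x)"

definition greedy_set :: "'v \<Rightarrow> nat \<Rightarrow> nat set \<Rightarrow> bool" where
  "greedy_set x m A \<longleftrightarrow> finite A \<and> A \<subseteq> {1..} \<and> card A = m \<and>
     (\<forall>a\<in>A. \<forall>b\<in>{1..} - A. norm (es a x) \<ge> norm (es b x))"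

definition sigma_hat :: "(nat \<Rightarrow> nat) \<Rightarrow> nat \<Rightarrow> 'v \<Rightarrow> real" where
  "sigma_hat ns m x = (MIN k\<in>{0..m}. N (x - partial_sum ns k x))"

definition strong_partially_greedy :: "(nat \<Rightarrow> nat) \<Rightarrow> (nat \<Rightarrow> nat) \<Rightarrow> bool" where
  "strong_partially_greedy s ns \<longleftrightarrow>
     (\<exists>C\<ge>1. \<forall>x\<in>V. \<forall>m\<in>s ` {1..}. \<forall>A. greedy_set x m A \<longrightarrow>
        N (x - proj A x) \<le> C * sigma_hat ns m x)"

definition quasi_greedy :: bool where
  "quasi_greedy \<longleftrightarrow>
     (\<exists>C>0. \<forall>x\<in>V. \<forall>m\<ge>1. \<forall>A. greedy_set x m A \<longrightarrow> N (proj A x) \<le> C * N x)"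

definition conservative :: "(nat \<Rightarrow> nat) \<Rightarrow> bool" where
  "conservative ns \<longleftrightarrow>
     (\<exists>C>0. \<forall>A B. finite A \<and> finite B \<and> A \<subseteq> ns ` {1..} \<and> B \<subseteq> {1..} \<and> card A \<le> card B \<and>
        (\<forall>a\<in>A. \<forall>b\<in>B \<inter> ns ` {1..}. a < b) \<longrightarrow>
        N (\<Sum>n\<in>A. e n) \<le> C * N (\<Sum>n\<in>B. e n))"

end

text \<open>
  Up to linear isomorphism every space with a Markushevich basis is a space of scalar sequences
  (identify a vector with its coordinates), so existence may be stated for a carrier inside this
  ambient space, with an arbitrary norm.
\<close>

definition coord_scale :: "'f::times \<Rightarrow> (nat \<Rightarrow> 'f) \<Rightarrow> nat \<Rightarrow> 'f" where
  "coord_scale c x = (\<lambda>k. c * x k)"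

end

theory Submission
  imports Defs
begin

text \<open>
  The indices \<open>ns p\<close> with \<open>s k < p \<le> s (k + 1)\<close> form the \<open>k\<close>-th \<^emph>\<open>block\<close>, and the first half
  of these positions form its \<^emph>\<open>first half\<close>. A vector supported outside the blocks has its \<open>\<ell>\<^sub>1\<close>
  norm. A vector supported in the \<open>k\<close>-th block has as norm the maximum of two quantities: the sum of
  the \<open>s k\<close> largest absolute values, and the largest absolute value of a partial sum over the first
  half. To combine the blocks, the norm is defined as the supremum of \<open>|\<Sum>i\<le>n. f i * x i|\<close> over
  all \<open>n\<close> and all \<open>f\<close> in a set \<open>F\<close> of coefficient sequences of modulus at most \<open>1\<close> that on each block either have at
  most \<open>s k\<close> nonzero entries or coincide with the indicator of the first half. The truncation at
  \<open>n\<close> makes the basis monotone, so that the Schauder property is automatic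
  (\<open>schauder\<close>). Truncation along \<open>ns\<close> is an ordinary truncation once the coordinates outside
  the range of \<open>ns\<close> are deleted, and deleting them is a contraction because every block lies in
  that range (\<open>schauder_along_ns\<close>).

  Let \<open>m = s K\<close>, let \<open>A\<close> be a greedy set of \<open>x\<close> of order \<open>m\<close>, and let \<open>Q\<close> consist of the first
  \<open>m\<close> terms of \<open>ns\<close>. Every block is contained in \<open>Q\<close> (if \<open>k < K\<close>) or disjoint from \<open>Q\<close> (if
  \<open>k \<ge> K\<close>), so deleting \<open>Q\<close> is a contraction, and on at most \<open>m\<close> coordinates outside \<open>Q\<close> the norm
  is the \<open>\<ell>\<^sub>1\<close> norm, since a block with \<open>k \<ge> K\<close> sees \<open>s k \<ge> m\<close> entries in full. Therefore the sum
  of \<open>|x i|\<close> over \<open>A - Q\<close> is bounded by the norm of \<open>y = x - P\<^sub>j x\<close>, where \<open>P\<^sub>j x\<close> is the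
  partial sum along \<open>ns\<close> of any order \<open>j \<le> m\<close>. As \<open>Q - A\<close> and
  \<open>A - Q\<close> have equally many elements and \<open>A\<close> is greedy, the sum over \<open>Q - A\<close> is not larger. This
  bounds the remainder of \<open>x\<close> by three times the norm of \<open>y\<close> (\<open>N_greedy_remainder_le\<close>).

  When \<open>s (k + 1) / s k\<close> is large, the two halves of the \<open>k\<close>-th block have a number of elements that
  is large compared with \<open>s k\<close>. The indicator of the first half has norm equal to that number,
  whereas the indicator of the second half, and the vector with alternating signs on the first half,
  have norm at most \<open>s k\<close>. The second half lies after the first one, which refutes
  conservativity (\<open>not_conservative\<close>); the positive part of the alternating vector is one of its
  greedy projections, which refutes quasi-greediness (\<open>not_quasi_greedy\<close>).
\<close>

section \<open>Finitely supported pairings of sequences\<close>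

definition unit_seq :: "nat \<Rightarrow> nat \<Rightarrow> 'f::zero_neq_one" where
  "unit_seq n = (\<lambda>i. if i = n then 1 else 0)"

definition restr :: "nat set \<Rightarrow> (nat \<Rightarrow> 'f::zero) \<Rightarrow> nat \<Rightarrow> 'f" where
  "restr E x = (\<lambda>i. if i \<in> E then x i else 0)"

definition pairing :: "(nat \<Rightarrow> 'f::comm_ring_1) \<Rightarrow> nat \<Rightarrow> (nat \<Rightarrow> 'f) \<Rightarrow> 'f" where
  "pairing f n x = (\<Sum>i=1..n. f i * x i)"

lemma pairing_linear:
  "pairing f n (x + y) = pairing f n x + pairing f n y"
  "pairing f n (x - y) = pairing f n x - pairing f n y"
  "pairing f n (coord_scale c x) = c * pairing f n x"
  by (simp_all add: pairing_def coord_scale_def algebra_simps sum.distrib sum_subtractf sum_distrib_left)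

lemma pairing_restr: "pairing f n (restr E x) = pairing (restr E f) n x"
  unfolding pairing_def restr_def by (rule sum.cong) auto

lemma pairing_restr_atMost: "pairing f n (restr {..m} x) = pairing f (min m n) x"
proof -
  have "pairing f n (restr {..m} x) = (\<Sum>i\<in>{1..n}. if i \<in> {..m} then f i * x i else 0)"
    unfolding pairing_def restr_def by (rule sum.cong) auto
  also have "\<dots> = (\<Sum>i\<in>{1..n} \<inter> {..m}. f i * x i)"
    by (subst sum.inter_restrict) auto
  also have "{1..n} \<inter> {..m} = {1..min m n}" by auto
  finally show ?thesis by (simp add: pairing_def)
qed

lemma restr_split: "x = restr E x + restr (- E) x" for x :: "nat \<Rightarrow> 'f::monoid_add"
  by (auto simp: restr_def fun_eq_iff)

lemma norm_pairing_restr_le: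
  fixes f x :: "nat \<Rightarrow> 'f::real_normed_field"
  assumes "\<And>i. norm (f i) \<le> 1" and "finite E"
  shows "norm (pairing f n (restr E x)) \<le> (\<Sum>i\<in>E. norm (x i))"
proof -
  have "norm (pairing f n (restr E x)) \<le> (\<Sum>i=1..n. if i \<in> E then norm (x i) else 0)"
    unfolding pairing_def restr_def
    by (rule sum_norm_le) (use assms(1) in \<open>auto simp: norm_mult mult_left_le_one_le\<close>)
  also have "\<dots> = (\<Sum>i\<in>{1..n} \<inter> E. norm (x i))"
    by (simp add: sum.inter_restrict)
  also have "\<dots> \<le> (\<Sum>i\<in>E. norm (x i))"
    by (rule sum_mono2) (use assms(2) in auto)
  finally show ?thesis .
qed

lemma vector_space_coord_scale: "vector_space (coord_scale :: 'f::field \<Rightarrow> _)"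
  by unfold_locales (auto simp: coord_scale_def fun_eq_iff algebra_simps)

lemma sum_unit_seq:
  fixes x :: "nat \<Rightarrow> 'f::comm_ring_1"
  assumes "finite E"
  shows "(\<Sum>i\<in>E. coord_scale (x i) (unit_seq i)) = restr E x"
proof
  fix j
  have "(\<Sum>i\<in>E. coord_scale (x i) (unit_seq i)) j = (\<Sum>i\<in>E. if i = j then x i else 0)"
    using assms by induction (auto simp: coord_scale_def unit_seq_def zero_fun_apply)
  then show "(\<Sum>i\<in>E. coord_scale (x i) (unit_seq i)) j = restr E x j"
    using assms by (simp add: restr_def)
qed

lemma sum_unit_seq_1:
  assumes "finite E"
  shows "(\<Sum>i\<in>E. unit_seq i) = restr E (\<lambda>_. 1 :: 'f::comm_ring_1)"
  using sum_unit_seq[OF assms, of "\<lambda>_. 1"] by (simp add: coord_scale_def)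

lemma independent_unit_seq:
  "module.independent coord_scale ((unit_seq :: nat \<Rightarrow> nat \<Rightarrow> 'f::field) ` {1..k})"
proof -
  interpret vector_space "coord_scale :: 'f \<Rightarrow> _" by (rule vector_space_coord_scale)
  have inj: "inj_on (unit_seq :: nat \<Rightarrow> nat \<Rightarrow> 'f) {1..k}"
    by (auto simp: inj_on_def unit_seq_def fun_eq_iff split: if_splits)
  show ?thesis
  proof (rule independent_if_scalars_zero)
    fix f :: "(nat \<Rightarrow> 'f) \<Rightarrow> 'f" and x :: "nat \<Rightarrow> 'f"
    assume sum0: "(\<Sum>x\<in>unit_seq ` {1..k}. coord_scale (f x) x) = (0 :: nat \<Rightarrow> 'f)"
      and x: "x \<in> unit_seq ` {1..k}"
    then obtain i where i: "i \<in> {1..k}" "x = unit_seq i" by auto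
    have "restr {1..k} (\<lambda>i. f (unit_seq i)) = 0"
      using sum0 unfolding sum.reindex[OF inj] by (simp add: sum_unit_seq comp_def)
    then have "restr {1..k} (\<lambda>i. f (unit_seq i)) i = 0" by simp
    then show "f x = 0" using i by (simp add: restr_def)
  qed simp
qed

section \<open>The sequence space normed by a family of coefficient sequences\<close>

text \<open>
  The bound on the coefficients makes the norm at most the \<open>\<ell>\<^sub>1\<close> norm on finitely supported
  sequences, and the unit vectors make it at least the supremum norm: the first yields
  approximation by simple vectors, the second boundedness of the coordinates.
\<close>
locale norming_family =
  fixes F :: "(nat \<Rightarrow> 'f::{real_normed_field,euclidean_space}) set"
  assumes norm_le_1: "f \<in> F \<Longrightarrow> norm (f i) \<le> 1"
    and unit_seq_in_F: "n \<ge> 1 \<Longrightarrow> unit_seq n \<in> F"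
begin

text \<open>
  This is the closure of the finitely supported sequences that vanish at \<open>0\<close>, written as a
  uniform tail condition so that it also entails finiteness of the supremum defining the norm.
\<close>
definition V :: "(nat \<Rightarrow> 'f) set" where
  "V = {x. x 0 = 0 \<and>
     (\<forall>\<epsilon>>0. \<exists>m. \<forall>f\<in>F. \<forall>n. norm (pairing f n (restr {m<..} x)) \<le> \<epsilon>)}"

definition N :: "(nat \<Rightarrow> 'f) \<Rightarrow> real" where
  "N x = (SUP (f, n)\<in>F \<times> UNIV. norm (pairing f n x))"

definition es :: "nat \<Rightarrow> (nat \<Rightarrow> 'f) \<Rightarrow> 'f" where
  "es n = (\<lambda>x\<in>V. x n)"

lemma F_nonempty: "F \<noteq> {}"
  using unit_seq_in_F[of 1] by auto

lemma restr_Compl_atMost: "restr (- {..m}) x = restr {m<..} x"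
  by (auto simp: restr_def)

lemma N_le:
  assumes "\<And>f n. f \<in> F \<Longrightarrow> norm (pairing f n x) \<le> c"
  shows "N x \<le> c"
  unfolding N_def by (rule cSUP_least) (use assms F_nonempty in auto)

lemma V_zero: "x \<in> V \<Longrightarrow> x 0 = 0"
  by (simp add: V_def)

lemma V_tail:
  assumes "x \<in> V" "\<epsilon> > 0"
  obtains m where "\<And>f n. f \<in> F \<Longrightarrow> norm (pairing f n (restr {m<..} x)) \<le> \<epsilon>"
  using assms unfolding V_def by blast

lemma pairing_le_N:
  assumes "x \<in> V" "f \<in> F"
  shows "norm (pairing f n x) \<le> N x"
proof -
  obtain m where m: "\<And>f n. f \<in> F \<Longrightarrow> norm (pairing f n (restr {m<..} x)) \<le> 1"
    using V_tail[OF assms(1), of 1] by auto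
  have "norm (pairing g k x) \<le> (\<Sum>i\<in>{..m}. norm (x i)) + 1" if "g \<in> F" for g k
  proof -
    have "pairing g k x = pairing g k (restr {..m} x) + pairing g k (restr {m<..} x)"
      by (subst restr_split[of x "{..m}"]) (simp add: pairing_linear restr_Compl_atMost)
    then show ?thesis
      using norm_pairing_restr_le[of g "{..m}" k x] norm_le_1 m[OF that, of k] that
        norm_triangle_ineq[of "pairing g k (restr {..m} x)" "pairing g k (restr {m<..} x)"] by simp
  qed
  then have "bdd_above ((\<lambda>(f, n). norm (pairing f n x)) ` (F \<times> UNIV))"
    by (intro bdd_aboveI[where M = "(\<Sum>i\<in>{..m}. norm (x i)) + 1"]) auto
  then show ?thesis
    unfolding N_def using assms(2) by (intro cSUP_upper2[where x = "(f, n)"]) auto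
qed

lemma subspace_V: "module.subspace coord_scale V"
proof -
  interpret vector_space "coord_scale :: 'f \<Rightarrow> _" by (rule vector_space_coord_scale)
  show ?thesis
  proof (rule subspaceI)
    show "0 \<in> V"
      by (auto simp: V_def pairing_def restr_def zero_fun_apply if_distrib cong: if_cong)
  next
    fix x y assume xy: "x \<in> V" "y \<in> V"
    have "\<exists>m. \<forall>f\<in>F. \<forall>n. norm (pairing f n (restr {m<..} (x + y))) \<le> \<epsilon>" if "\<epsilon> > 0" for \<epsilon>
    proof -
      have half: "\<epsilon> / 4 > 0" using that by simp
      obtain m1 where m1: "\<And>f n. f \<in> F \<Longrightarrow> norm (pairing f n (restr {m1<..} x)) \<le> \<epsilon> / 4"
        using V_tail[OF xy(1) half] by blast
      obtain m2 where m2: "\<And>f n. f \<in> F \<Longrightarrow> norm (pairing f n (restr {m2<..} y)) \<le> \<epsilon> / 4"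
        using V_tail[OF xy(2) half] by blast
      \<comment> \<open>A later tail is an earlier tail minus a truncation of it, hence at most twice as large.\<close>
      have shift: "pairing f n (restr {max k l<..} z) =
          pairing f n (restr {k<..} z) - pairing f (min (max k l) n) (restr {k<..} z)"
        for f z k l n
      proof -
        have "restr {max k l<..} z = restr {k<..} z - restr {..max k l} (restr {k<..} z)"
          by (auto simp: restr_def fun_eq_iff)
        then show ?thesis by (simp add: pairing_linear pairing_restr_atMost)
      qed
      have "norm (pairing f n (restr {max m1 m2<..} (x + y))) \<le> \<epsilon>" if f: "f \<in> F" for f n
      proof -
        have "restr {max m1 m2<..} (x + y) = restr {max m1 m2<..} x + restr {max m1 m2<..} y"
          by (auto simp: restr_def fun_eq_iff)
        then have "norm (pairing f n (restr {max m1 m2<..} (x + y)))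
            \<le> norm (pairing f n (restr {max m1 m2<..} x)) + norm (pairing f n (restr {max m1 m2<..} y))"
          by (simp add: pairing_linear norm_triangle_ineq)
        also have "norm (pairing f n (restr {max m1 m2<..} x)) \<le> \<epsilon> / 4 + \<epsilon> / 4"
          unfolding shift[of f n m1 m2 x] by (rule norm_triangle_le_diff) (intro add_mono m1 f)
        also have "norm (pairing f n (restr {max m1 m2<..} y)) \<le> \<epsilon> / 4 + \<epsilon> / 4"
          unfolding shift[of f n m2 m1 y, unfolded max.commute[of m2 m1]]
          by (rule norm_triangle_le_diff) (intro add_mono m2 f)
        finally show ?thesis by simp
      qed
      then show ?thesis by blast
    qed
    then show "x + y \<in> V" using xy by (auto simp: V_def)
  next
    fix c x assume x: "x \<in> V"
    have "\<exists>m. \<forall>f\<in>F. \<forall>n. norm (pairing f n (restr {m<..} (coord_scale c x))) \<le> \<epsilon>" if "\<epsilon> > 0" for \<epsilon>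
    proof -
      have "\<epsilon> / (norm c + 1) > 0" using that by (simp add: add_nonneg_pos)
      then obtain m where m: "\<And>f n. f \<in> F \<Longrightarrow> norm (pairing f n (restr {m<..} x)) \<le> \<epsilon> / (norm c + 1)"
        using V_tail[OF x] by blast
      have "norm (pairing f n (restr {m<..} (coord_scale c x))) \<le> \<epsilon>" if f: "f \<in> F" for f n
      proof -
        have "restr {m<..} (coord_scale c x) = coord_scale c (restr {m<..} x)"
          by (auto simp: restr_def coord_scale_def fun_eq_iff)
        then have "norm (pairing f n (restr {m<..} (coord_scale c x))) = norm c * norm (pairing f n (restr {m<..} x))"
          by (simp add: pairing_linear norm_mult)
        also have "\<dots> \<le> (norm c + 1) * (\<epsilon> / (norm c + 1))"
          by (intro mult_mono m f) simp_all
        also have "\<dots> = \<epsilon>"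
          by (simp add: add_nonneg_eq_0_iff)
        finally show ?thesis .
      qed
      then show ?thesis by blast
    qed
    then show "coord_scale c x \<in> V" using x by (auto simp: V_def coord_scale_def)
  qed
qed

lemma coord_le_N:
  assumes "x \<in> V"
  shows "norm (x i) \<le> N x"
proof (cases "i \<ge> 1")
  case True
  have "pairing (unit_seq i) i x = (\<Sum>j=1..i. if j = i then x j else 0)"
    unfolding pairing_def by (rule sum.cong) (auto simp: unit_seq_def)
  then have "pairing (unit_seq i) i x = x i" using True by simp
  then show ?thesis using pairing_le_N[OF assms unit_seq_in_F[OF True], of i] by simp
next
  case False
  then have "x i = 0" using V_zero[OF assms] by (cases i) auto
  moreover have "0 \<le> N x"
    by (rule order_trans[OF norm_ge_zero pairing_le_N[OF assms unit_seq_in_F[of 1], of 1]]) simp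
  ultimately show ?thesis by simp
qed

sublocale normed_on coord_scale V N
proof (intro normed_on.intro vector_space_coord_scale normed_on_axioms.intro)
  interpret vector_space "coord_scale :: 'f \<Rightarrow> _" by (rule vector_space_coord_scale)
  show "subspace V" by (rule subspace_V)
  fix x assume x: "x \<in> V"
  show nonneg: "0 \<le> N x"
    by (rule order_trans[OF norm_ge_zero coord_le_N[OF x, of 0]])
  show "N x = 0 \<longleftrightarrow> x = 0"
  proof
    assume "N x = 0"
    then show "x = 0" using coord_le_N[OF x] by (auto simp: fun_eq_iff)
  next
    assume "x = 0"
    then have "N x \<le> 0" by (intro N_le) (simp add: pairing_def)
    then show "N x = 0" using nonneg by simp
  qed
  show "N (coord_scale c x) = norm c * N x" for c
  proof -
    have cx: "coord_scale c x \<in> V" using subspace_scale[OF subspace_V x] .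
    have le: "N (coord_scale c x) \<le> norm c * N x"
      by (rule N_le) (simp add: pairing_linear norm_mult pairing_le_N[OF x] mult_left_mono)
    show ?thesis
    proof (cases "c = 0")
      case True
      then show ?thesis
        using le order_trans[OF norm_ge_zero coord_le_N[OF cx, of 0]] by simp
    next
      case False
      have "N x \<le> N (coord_scale c x) / norm c"
        by (rule N_le) (use pairing_le_N[OF cx] False in \<open>simp add: pairing_linear norm_mult field_simps\<close>)
      then show ?thesis using le False by (simp add: field_simps)
    qed
  qed
  fix y assume y: "y \<in> V"
  show "N (x + y) \<le> N x + N y"
    by (rule N_le) (auto simp: pairing_linear intro!: norm_triangle_le add_mono pairing_le_N x y)
qed

lemma finite_support_in_V:
  assumes "finite E" "0 \<notin> E"
  shows "restr E x \<in> V"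
proof -
  obtain m where "E \<subseteq> {..m}" using finite_nat_iff_bounded_le[of E] assms(1) by auto
  then have "restr {m<..} (restr E x) = (\<lambda>_. 0)" by (auto simp: restr_def fun_eq_iff)
  then show ?thesis
    using assms(2) by (auto simp: V_def pairing_def restr_def[of E] intro!: exI[of _ m])
qed

lemma N_restr_le_sum:
  assumes "finite E"
  shows "N (restr E x) \<le> (\<Sum>i\<in>E. norm (x i))"
  by (rule N_le) (rule norm_pairing_restr_le[OF norm_le_1 assms])

lemma restr_atMost_in_V: "x \<in> V \<Longrightarrow> restr {..m} x \<in> V"
proof -
  assume "x \<in> V"
  then have "restr {..m} x = restr {1..m} x"
    using V_zero[of x] by (auto simp: restr_def fun_eq_iff Suc_le_eq)
  then show ?thesis using finite_support_in_V[of "{1..m}" x] by simp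
qed

lemma N_restr_atMost_le:
  assumes "x \<in> V"
  shows "N (restr {..m} x) \<le> N x"
  by (rule N_le) (simp add: pairing_restr_atMost pairing_le_N[OF assms])

lemma restr_greaterThan: "restr {m<..} x = x - restr {..m} x"
  for x :: "nat \<Rightarrow> 'f"
  by (auto simp: restr_def fun_eq_iff)

lemma restr_greaterThan_in_V: "x \<in> V \<Longrightarrow> restr {m<..} x \<in> V"
  by (simp add: restr_greaterThan subspace_diff[OF subspace_V] restr_atMost_in_V)

text \<open>
  The definition of the space provides one small tail for each tolerance; all later tails are
  differences of that tail and its truncations, which at most doubles the tolerance.
\<close>
lemma tail_tendsto_0:
  assumes "x \<in> V"
  shows "(\<lambda>m. N (restr {m<..} x)) \<longlonglongrightarrow> 0"
proof (rule LIMSEQ_I)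
  fix r :: real assume "r > 0"
  then obtain m where m: "\<And>f n. f \<in> F \<Longrightarrow> norm (pairing f n (restr {m<..} x)) \<le> r / 4"
    using V_tail[OF assms, of "r / 4"] by auto
  have "norm (N (restr {k<..} x) - 0) < r" if "k \<ge> m" for k
  proof -
    have "restr {k<..} x = restr {m<..} x - restr {..k} (restr {m<..} x)"
      using that by (auto simp: restr_def fun_eq_iff)
    then have "norm (pairing f n (restr {k<..} x)) \<le> r / 4 + r / 4" if "f \<in> F" for f n
      by (simp only: pairing_linear pairing_restr_atMost)
        (intro norm_triangle_le_diff add_mono m that)
    then have "N (restr {k<..} x) \<le> r / 4 + r / 4"
      by (rule N_le)
    then show ?thesis
      using N_nonneg[OF restr_greaterThan_in_V[OF assms, of k]] \<open>r > 0\<close> by simp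
  qed
  then show "\<exists>no. \<forall>n\<ge>no. norm (N (restr {n<..} x) - 0) < r" by blast
qed

text \<open>
  Coordinates of a Cauchy sequence converge because they are bounded by the norm. Each pairing
  involves finitely many coordinates, so the Cauchy estimate passes to the limit uniformly in the
  coefficient sequences; this gives both the tail condition of the limit and the convergence.
\<close>
lemma mcomplete_V: "mcomplete"
  unfolding mcomplete_def
proof (intro allI impI)
  fix \<sigma> assume cauchy: "MCauchy \<sigma>"
  then have \<sigma>V: "\<sigma> p \<in> V" for p by (auto simp: MCauchy_def)
  have ev: "\<exists>P. \<forall>p\<ge>P. \<forall>q\<ge>P. N (\<sigma> p - \<sigma> q) < \<epsilon>" if "\<epsilon> > 0" for \<epsilon>
    using cauchy that \<sigma>V unfolding MCauchy_def by simp
  have diffV: "\<sigma> p - \<sigma> q \<in> V" for p q using subspace_diff[OF subspace_V] \<sigma>V by blast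
  have "Cauchy (\<lambda>p. \<sigma> p i)" for i
  proof (rule metric_CauchyI)
    fix \<epsilon> :: real assume "\<epsilon> > 0"
    then obtain P where P: "\<And>p q. p \<ge> P \<Longrightarrow> q \<ge> P \<Longrightarrow> N (\<sigma> p - \<sigma> q) < \<epsilon>" using ev by blast
    have "dist (\<sigma> p i) (\<sigma> q i) < \<epsilon>" if "p \<ge> P" "q \<ge> P" for p q
      using coord_le_N[OF diffV, of p q i] P[OF that] by (simp add: dist_norm)
    then show "\<exists>M. \<forall>m\<ge>M. \<forall>n\<ge>M. dist (\<sigma> m i) (\<sigma> n i) < \<epsilon>" by blast
  qed
  then have "\<forall>i. \<exists>l. (\<lambda>p. \<sigma> p i) \<longlonglongrightarrow> l"
    using Cauchy_convergent unfolding convergent_def by blast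
  then obtain x where lim: "\<And>i. (\<lambda>p. \<sigma> p i) \<longlonglongrightarrow> x i" by metis
  have close: "\<exists>P. \<forall>p\<ge>P. \<forall>f\<in>F. \<forall>n. norm (pairing f n (\<sigma> p - x)) \<le> \<epsilon>" if eps: "\<epsilon> > 0" for \<epsilon>
  proof -
    obtain P where P: "\<And>p q. p \<ge> P \<Longrightarrow> q \<ge> P \<Longrightarrow> N (\<sigma> p - \<sigma> q) < \<epsilon>" using ev[OF eps] by blast
    have "norm (pairing f n (\<sigma> p - x)) \<le> \<epsilon>" if "p \<ge> P" "f \<in> F" for p f n
    proof (rule LIMSEQ_le_const2)
      show "(\<lambda>q. norm (pairing f n (\<sigma> p - \<sigma> q))) \<longlonglongrightarrow> norm (pairing f n (\<sigma> p - x))"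
        unfolding pairing_def by (auto intro!: tendsto_intros lim)
      show "\<exists>Q. \<forall>q\<ge>Q. norm (pairing f n (\<sigma> p - \<sigma> q)) \<le> \<epsilon>"
        using P[OF that(1)] pairing_le_N[OF diffV that(2)] by (meson less_imp_le order_trans)
    qed
    then show ?thesis by blast
  qed
  have "x \<in> V"
    unfolding V_def
  proof (safe)
    show "x 0 = 0" using lim[of 0] V_zero[OF \<sigma>V] by (simp add: LIMSEQ_const_iff)
  next
    fix \<epsilon> :: real assume "\<epsilon> > 0"
    then obtain p where p: "\<And>f n. f \<in> F \<Longrightarrow> norm (pairing f n (\<sigma> p - x)) \<le> \<epsilon> / 3"
      using close[of "\<epsilon> / 3"] by auto
    obtain m where m: "\<And>f n. f \<in> F \<Longrightarrow> norm (pairing f n (restr {m<..} (\<sigma> p))) \<le> \<epsilon> / 3"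
      using V_tail[OF \<sigma>V[of p], of "\<epsilon> / 3"] \<open>\<epsilon> > 0\<close> by auto
    have "norm (pairing f n (restr {m<..} x)) \<le> \<epsilon>" if f: "f \<in> F" for f n
    proof -
      have "restr {m<..} x = restr {m<..} (\<sigma> p) - ((\<sigma> p - x) - restr {..m} (\<sigma> p - x))"
        by (auto simp: restr_def fun_eq_iff)
      then have "norm (pairing f n (restr {m<..} x)) \<le> \<epsilon> / 3 + (\<epsilon> / 3 + \<epsilon> / 3)"
        by (simp only: pairing_linear(2)[of f n "restr {m<..} (\<sigma> p)"]
              pairing_linear(2)[of f n "\<sigma> p - x"] pairing_restr_atMost)
          (intro norm_triangle_le_diff add_mono m p f)
      then show ?thesis by simp
    qed
    then show "\<exists>m. \<forall>f\<in>F. \<forall>n. norm (pairing f n (restr {m<..} x)) \<le> \<epsilon>" by blast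
  qed
  have "limitin mtopology \<sigma> x sequentially"
    unfolding limit_metric_sequentially
  proof (intro conjI allI impI \<open>x \<in> V\<close>)
    fix \<epsilon> :: real assume "\<epsilon> > 0"
    then obtain P where P: "\<And>p f n. p \<ge> P \<Longrightarrow> f \<in> F \<Longrightarrow> norm (pairing f n (\<sigma> p - x)) \<le> \<epsilon> / 2"
      using close[of "\<epsilon> / 2"] by auto
    have "N (\<sigma> p - x) < \<epsilon>" if "p \<ge> P" for p
      using N_le[OF P[OF that]] \<open>\<epsilon> > 0\<close> by force
    then show "\<exists>Na. \<forall>n\<ge>Na. \<sigma> n \<in> V \<and> (if \<sigma> n \<in> V \<and> x \<in> V then N (\<sigma> n - x) else 0) < \<epsilon>"
      using \<sigma>V \<open>x \<in> V\<close> by auto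
  qed
  then show "\<exists>x. limitin mtopology \<sigma> x sequentially" by blast
qed

lemma closure_of_eq_V:
  assumes "S \<subseteq> V" and "\<And>x r. x \<in> V \<Longrightarrow> r > 0 \<Longrightarrow> \<exists>y\<in>S. N (x - y) < r"
  shows "mtopology closure_of S = V"
  unfolding metric_closure_of using assms by (fastforce simp: subset_iff)

text \<open>
  Finite lists over a countable dense set of scalars approximate: the tail is cut off, and on the
  finitely many remaining coordinates the \<open>\<ell>\<^sub>1\<close> norm dominates.
\<close>
lemma separable_V: "\<exists>D. countable D \<and> D \<subseteq> V \<and> mtopology closure_of D = V"
proof -
  obtain Q :: "'f set" where Q: "countable Q" "\<And>X. open X \<Longrightarrow> X \<noteq> {} \<Longrightarrow> \<exists>d\<in>Q. d \<in> X"
    using countable_dense_setE by blast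
  \<comment> \<open>The entry of a list at position \<open>0\<close> is ignored, since the space has no coordinate \<open>0\<close>.\<close>
  define D where "D = (\<lambda>l. restr {1..<length l} (\<lambda>i. l ! i)) ` lists Q"
  have "countable D" unfolding D_def using Q(1) by blast
  moreover have DV: "D \<subseteq> V" unfolding D_def by (auto intro!: finite_support_in_V)
  moreover have "mtopology closure_of D = V"
  proof (rule closure_of_eq_V[OF DV])
    fix x and r :: real assume x: "x \<in> V" and r: "r > 0"
    obtain m where m: "N (restr {m<..} x) < r / 2"
      using order_tendstoD(2)[OF tail_tendsto_0[OF x], of "r / 2"] r
      by (auto simp: eventually_sequentially)
    define \<delta> where "\<delta> = r / (2 * (real m + 1))"
    have "\<delta> > 0" using r by (simp add: \<delta>_def)
    then have "\<exists>d\<in>Q. d \<in> ball a \<delta>" for a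
      by (intro Q(2)) auto
    then obtain d where d: "\<And>a. d a \<in> Q" "\<And>a. dist a (d a) < \<delta>" by (metis mem_ball)
    define l where "l = map (\<lambda>i. d (x i)) [0..<Suc m]"
    define y where "y = restr {1..<length l} (\<lambda>i. l ! i)"
    have "l \<in> lists Q" unfolding l_def using d(1) by auto
    then have "y \<in> D" unfolding y_def D_def by blast
    have "x - y = restr {m<..} x + restr {1..m} (x - y)"
      using V_zero[OF x]
      by (auto simp: y_def restr_def fun_eq_iff l_def Suc_le_eq)
    then have "N (x - y) \<le> N (restr {m<..} x) + N (restr {1..m} (x - y))"
      using N_triangle[OF restr_greaterThan_in_V[OF x, of m] finite_support_in_V[of "{1..m}" "x - y"]] by simp
    also have "N (restr {1..m} (x - y)) \<le> (\<Sum>i\<in>{1..m}. norm ((x - y) i))"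
      by (rule N_restr_le_sum) simp
    also have "\<dots> \<le> (\<Sum>i\<in>{1..m}. \<delta>)"
    proof (rule sum_mono)
      fix i assume "i \<in> {1..m}"
      then have "y i = d (x i)" by (simp add: y_def restr_def l_def del: upt_Suc)
      then show "norm ((x - y) i) \<le> \<delta>" using d(2)[of "x i"] by (simp add: dist_norm)
    qed
    also have "\<dots> \<le> r / 2"
      using r by (simp add: \<delta>_def divide_simps)
    finally show "\<exists>y\<in>D. N (x - y) < r" using m \<open>y \<in> D\<close> by (intro bexI[of _ y]) auto
  qed
  ultimately show ?thesis by blast
qed

lemma unit_seq_eq_restr: "unit_seq n = restr {n} (\<lambda>_. 1)"
  by (auto simp: unit_seq_def restr_def)

lemma unit_seq_in_V: "n \<ge> 1 \<Longrightarrow> unit_seq n \<in> V"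
  unfolding unit_seq_eq_restr by (rule finite_support_in_V) auto

lemma N_unit_seq: "n \<ge> 1 \<Longrightarrow> N (unit_seq n) = 1"
  using N_restr_le_sum[of "{n}" "\<lambda>_. 1"] coord_le_N[OF unit_seq_in_V, of n n]
  by (simp add: unit_seq_eq_restr) (simp add: restr_def)

lemma infinite_dimensional_V: "finite B \<Longrightarrow> span B \<noteq> V"
proof
  assume B: "finite B" "span B = V"
  have "unit_seq ` {1..Suc (card B)} \<subseteq> span B"
    unfolding B(2) by (auto intro: unit_seq_in_V)
  then have "card ((unit_seq :: nat \<Rightarrow> nat \<Rightarrow> 'f) ` {1..Suc (card B)}) \<le> card B"
    using independent_span_bound[OF B(1) independent_unit_seq] by blast
  moreover have "inj_on (unit_seq :: nat \<Rightarrow> nat \<Rightarrow> 'f) {1..Suc (card B)}"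
    by (auto simp: inj_on_def unit_seq_def fun_eq_iff split: if_splits)
  ultimately show False by (simp add: card_image)
qed

lemma es_in_dual: "es n \<in> dual"
  unfolding dual_def es_def
  using subspace_add[OF subspace_V] subspace_scale[OF subspace_V] coord_le_N
  by (auto simp: coord_scale_def intro!: exI[of _ 1])

lemma dual_norm_es:
  assumes "n \<ge> 1"
  shows "dual_norm (es n) = 1"
  unfolding dual_norm_def
proof (rule cSup_eq_maximum)
  show "1 \<in> (\<lambda>x. norm (es n x)) ` {x \<in> V. N x \<le> 1}"
    by (rule image_eqI[of _ _ "unit_seq n"])
      (use assms unit_seq_in_V N_unit_seq in \<open>auto simp: es_def unit_seq_def\<close>)
  fix r assume "r \<in> (\<lambda>x. norm (es n x)) ` {x \<in> V. N x \<le> 1}"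
  then show "r \<le> 1" using coord_le_N[of _ n] by (fastforce simp: es_def)
qed

lemma restr_atMost_in_span:
  assumes "x \<in> V"
  shows "restr {..m} x \<in> span (unit_seq ` {1..})"
proof -
  have "restr {..m} x = restr {1..m} x"
    using V_zero[OF assms] by (auto simp: restr_def fun_eq_iff Suc_le_eq)
  also have "\<dots> = (\<Sum>i\<in>{1..m}. coord_scale (x i) (unit_seq i))"
    by (rule sum_unit_seq[symmetric]) simp
  also have "\<dots> \<in> span (unit_seq ` {1..})"
    by (intro span_sum span_scale span_base) auto
  finally show ?thesis .
qed

sublocale basis_on coord_scale V N unit_seq es
proof
  show "mcomplete" by (rule mcomplete_V)
  show "\<exists>D. countable D \<and> D \<subseteq> V \<and> mtopology closure_of D = V" by (rule separable_V)
  show "\<And>B. finite B \<Longrightarrow> span B \<noteq> V" by (rule infinite_dimensional_V)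
  show "\<And>n. 1 \<le> n \<Longrightarrow> unit_seq n \<in> V" by (rule unit_seq_in_V)
  show "\<And>n. 1 \<le> n \<Longrightarrow> es n \<in> dual" by (rule es_in_dual)
  show "mtopology closure_of (span (unit_seq ` {1..})) = V"
  proof (rule closure_of_eq_V)
    show "span (unit_seq ` {1..}) \<subseteq> V"
      by (rule span_minimal[OF _ subspace_V]) (auto intro: unit_seq_in_V)
    fix x and r :: real assume x: "x \<in> V" and "r > 0"
    then obtain m where "N (restr {m<..} x) < r"
      using order_tendstoD(2)[OF tail_tendsto_0[OF x], of r]
      by (auto simp: eventually_sequentially)
    then show "\<exists>y\<in>span (unit_seq ` {1..}). N (x - y) < r"
      using restr_atMost_in_span[OF x, of m] by (auto simp: restr_greaterThan)
  qed
  show "es j (unit_seq k) = (if j = k then 1 else 0)" if "1 \<le> j" "1 \<le> k" for j k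
    using that unit_seq_in_V by (simp add: es_def unit_seq_def)
  show "\<exists>a b. 0 < a \<and> (\<forall>n\<ge>1. a \<le> N (unit_seq n) \<and> a \<le> dual_norm (es n) \<and>
      N (unit_seq n) \<le> b \<and> dual_norm (es n) \<le> b)"
    by (rule exI[of _ 1], rule exI[of _ 1]) (simp add: N_unit_seq dual_norm_es)
qed

lemma proj_eq_restr:
  assumes "x \<in> V" "finite E"
  shows "proj E x = restr E x"
  using assms by (simp add: proj_def es_def sum_unit_seq)

text \<open>
  A functional \<open>\<phi>\<close> composed with the truncations is a finite combination of coordinate functionals,
  and these compositions converge pointwise to \<open>\<phi>\<close> because tails tend to \<open>0\<close> in norm.
\<close>
lemma markushevich: "markushevich"
proof -
  let ?S = "{(\<lambda>x\<in>V. \<Sum>n\<in>A. c n * es n x) | A c. finite A \<and> A \<subseteq> {1..}}"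
  have top: "topspace weak_star = dual"
    by (auto simp: weak_star_def dual_def PiE_def)
  have "\<phi> \<in> weak_star closure_of ?S" if \<phi>: "\<phi> \<in> dual" for \<phi>
  proof -
    have add: "\<phi> (x + y) = \<phi> x + \<phi> y" if "x \<in> V" "y \<in> V" for x y
      using \<phi> that unfolding dual_def by blast
    have scale: "\<phi> (coord_scale c x) = c * \<phi> x" if "x \<in> V" for c x
      using \<phi> that unfolding dual_def by blast
    obtain C where bound: "\<And>x. x \<in> V \<Longrightarrow> norm (\<phi> x) \<le> C * N x"
      using \<phi> unfolding dual_def by blast
    have ext: "\<phi> \<in> extensional V" using \<phi> unfolding dual_def by blast
    define \<psi> where "\<psi> m = (\<lambda>x\<in>V. \<Sum>n\<in>{1..m}. \<phi> (unit_seq n) * es n x)" for m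
    have \<psi>_S: "\<psi> m \<in> ?S" for m
      unfolding \<psi>_def by force
    have \<psi>_eq: "\<psi> m x = \<phi> (restr {..m} x)" if x: "x \<in> V" for m x
    proof (induction m)
      case 0
      have "restr {..0} x = coord_scale 0 x"
        using V_zero[OF x] by (auto simp: restr_def coord_scale_def fun_eq_iff)
      then show ?case using scale[OF x, of 0] x by (simp add: \<psi>_def del: scale_zero_left)
    next
      case (Suc m)
      have "restr {..Suc m} x = restr {..m} x + coord_scale (x (Suc m)) (unit_seq (Suc m))"
        by (auto simp: restr_def coord_scale_def unit_seq_def fun_eq_iff le_Suc_eq)
      then have "\<phi> (restr {..Suc m} x) = \<phi> (restr {..m} x) + x (Suc m) * \<phi> (unit_seq (Suc m))"
        using add[OF restr_atMost_in_V[OF x] subspace_scale[OF subspace_V unit_seq_in_V]]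
          scale[OF unit_seq_in_V] by simp
      then show ?case using Suc x by (simp add: \<psi>_def es_def mult.commute)
    qed
    have bound_\<psi>: "norm (\<psi> m x) \<le> \<bar>C\<bar> * N x" if x: "x \<in> V" for m x
    proof -
      have "norm (\<psi> m x) \<le> C * N (restr {..m} x)"
        using bound[OF restr_atMost_in_V[OF x]] \<psi>_eq[OF x] by simp
      also have "\<dots> \<le> \<bar>C\<bar> * N x"
        by (intro mult_mono N_restr_atMost_le[OF x] N_nonneg restr_atMost_in_V[OF x]) auto
      finally show ?thesis .
    qed
    have \<psi>_dual: "\<psi> m \<in> dual" for m
      unfolding dual_def
    proof (intro CollectI conjI ballI allI)
      show "\<psi> m \<in> extensional V" by (simp add: \<psi>_def)
      show "\<psi> m (x + y) = \<psi> m x + \<psi> m y" if "x \<in> V" "y \<in> V" for x y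
        using that subspace_add[OF subspace_V that]
        by (simp add: \<psi>_def es_def algebra_simps sum.distrib)
      show "\<psi> m (coord_scale c x) = c * \<psi> m x" if "x \<in> V" for c x
        using that subspace_scale[OF subspace_V that, of c]
        by (simp add: \<psi>_def es_def coord_scale_def sum_distrib_left algebra_simps)
      show "\<exists>C. \<forall>x\<in>V. norm (\<psi> m x) \<le> C * N x" using bound_\<psi> by blast
    qed
    have "(\<lambda>m. \<psi> m x) \<longlonglongrightarrow> \<phi> x" if x: "x \<in> V" for x
    proof (rule LIM_zero_cancel, rule Lim_null_comparison)
      show "\<forall>\<^sub>F m in sequentially. norm (\<psi> m x - \<phi> x) \<le> C * N (restr {m<..} x)"
      proof (rule always_eventually, rule allI)
        fix m
        have "\<phi> x = \<phi> (restr {..m} x) + \<phi> (restr {m<..} x)"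
          using add[OF restr_atMost_in_V[OF x] restr_greaterThan_in_V[OF x], of m m] restr_split[of x "{..m}"]
          by (simp add: restr_Compl_atMost)
        then show "norm (\<psi> m x - \<phi> x) \<le> C * N (restr {m<..} x)"
          using bound[OF restr_greaterThan_in_V[OF x, of m]] \<psi>_eq[OF x] by simp
      qed
      show "(\<lambda>m. C * N (restr {m<..} x)) \<longlonglongrightarrow> 0"
        using tendsto_mult_left[OF tail_tendsto_0[OF x], of C] by simp
    qed
    then have "limitin (product_topology (\<lambda>_. euclidean) V) \<psi> \<phi> sequentially"
      unfolding limitin_componentwise using ext by (auto simp: \<psi>_def)
    then have "limitin weak_star \<psi> \<phi> sequentially"
      unfolding weak_star_def limitin_subtopology using \<phi> \<psi>_dual by auto
    then have "\<exists>y. y \<in> ?S \<and> y \<in> T" if "\<phi> \<in> T" "openin weak_star T" for T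
    proof -
      have "\<forall>\<^sub>F m in sequentially. \<psi> m \<in> T"
        using \<open>limitin weak_star \<psi> \<phi> sequentially\<close> that by (simp add: limitin_def)
      then obtain m where "\<psi> m \<in> T"
        by (metis eventually_sequentially order_refl)
      with \<psi>_S show ?thesis by (intro exI[of _ "\<psi> m"] conjI)
    qed
    then show ?thesis
      unfolding in_closure_of top using \<phi> by (intro conjI allI impI) (rule \<phi>, simp only:)
  qed
  then have "dual \<subseteq> weak_star closure_of ?S" by (rule subsetI)
  moreover have "weak_star closure_of ?S \<subseteq> dual"
    using closure_of_subset_topspace[of weak_star ?S] top by simp
  ultimately show ?thesis unfolding markushevich_def by (rule subset_antisym[rotated])
qed

lemma schauder: "schauder"
proof -
  have "N (\<Sum>n=1..m. coord_scale (es n x) (unit_seq n)) \<le> 1 * N x" if x: "x \<in> V" for x m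
  proof -
    have "(\<Sum>n=1..m. coord_scale (es n x) (unit_seq n)) = restr {..m} x"
      using V_zero[OF x] x
      by (auto simp: es_def sum_unit_seq restr_def fun_eq_iff Suc_le_eq)
    then show ?thesis using N_restr_atMost_le[OF x] by simp
  qed
  then show ?thesis unfolding schauder_def using markushevich by blast
qed

end

section \<open>Alternating signs\<close>

text \<open>
  The condition \<open>ns p \<le> n\<close> is how truncation at \<open>n\<close> appears on positions: by monotonicity it
  leaves an initial segment, so that the sum is again an alternating sum.
\<close>
lemma norm_sum_alternating_le_1:
  fixes ns :: "nat \<Rightarrow> nat"
  assumes "strict_mono_on {a<..} ns"
  shows "norm (\<Sum>p | p \<in> {a<..a + d} \<and> ns p \<le> n. (- 1 :: 'f::real_normed_field) ^ p) \<le> 1"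
proof (induction d)
  case (Suc d)
  show ?case
  proof (cases "ns (a + Suc d) \<le> n")
    case True
    have "ns p \<le> n" if "p \<in> {a<..a + Suc d}" for p
      using strict_mono_on_leD[OF assms, of p "a + Suc d"] that True by auto
    then have "{p. p \<in> {a<..a + Suc d} \<and> ns p \<le> n} = {a<..a + Suc d}" by auto
    moreover have "(\<Sum>p\<in>{a<..a + e}. (- 1 :: 'f) ^ p) = (if even e then 0 else - ((- 1) ^ a))" for e
    proof (induction e)
      case (Suc e)
      have "{a<..a + Suc e} = insert (a + Suc e) {a<..a + e}" by auto
      then show ?case using Suc by (auto simp: power_add)
    qed simp
    ultimately show ?thesis by (simp only:) (simp add: norm_power)
  next
    case False
    then have "{p. p \<in> {a<..a + Suc d} \<and> ns p \<le> n} = {p. p \<in> {a<..a + d} \<and> ns p \<le> n}"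
      by (auto simp: le_Suc_eq)
    then show ?thesis using Suc by simp
  qed
qed simp

lemma card_even_greaterThanAtMost: "card {p \<in> {a<..a + d}. even p} \<ge> d div 2" for a d :: nat
proof -
  have "(\<lambda>j. 2 * (a div 2 + j)) ` {1..d div 2} \<subseteq> {p \<in> {a<..a + d}. even p}" by auto
  then have "card ((\<lambda>j. 2 * (a div 2 + j)) ` {1..d div 2}) \<le> card {p \<in> {a<..a + d}. even p}"
    by (intro card_mono) auto
  then show ?thesis by (subst (asm) card_image) (auto simp: inj_on_def)
qed

section \<open>The norm with blocks between consecutive terms\<close>

text \<open>
  On the \<open>k\<close>-th block the coefficient sequences with at most \<open>s k\<close> nonzero entries norm the sum of
  the \<open>s k\<close> largest moduli; the indicator of the first half, together with the truncations in the
  norm, provides the partial sums over the first half. Coefficients outside the blocks are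
  subject only to the bound \<open>1\<close>, which gives the \<open>\<ell>\<^sub>1\<close> norm there.
\<close>
locale gap_family =
  fixes ns s :: "nat \<Rightarrow> nat" and F :: "(nat \<Rightarrow> 'f::{real_normed_field,euclidean_space}) set"
    and block half :: "nat \<Rightarrow> nat set"
  defines "block k \<equiv> ns ` {s k<..s (Suc k)}"
    and "half k \<equiv> ns ` {s k<..s k + (s (Suc k) - s k) div 2}"
    and "F \<equiv> {f. (\<forall>i. norm (f i) \<le> 1) \<and>
      (\<forall>k\<ge>1. card {i \<in> block k. f i \<noteq> 0} \<le> s k \<or>
        (\<forall>i\<in>block k. f i = (if i \<in> half k then 1 else 0)))}"
  assumes ns_mono: "strict_mono_on {1..} ns" and ns_pos: "\<And>k. k \<ge> 1 \<Longrightarrow> ns k \<ge> 1"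
    and s_mono: "strict_mono_on {1..} s" and s_pos: "\<And>k. k \<ge> 1 \<Longrightarrow> s k \<ge> 1"
begin

sublocale norming_family F
proof
  show "f \<in> F \<Longrightarrow> norm (f i) \<le> 1" for f i by (auto simp: F_def)
  fix n :: nat assume "n \<ge> 1"
  have "card {i \<in> block k. unit_seq n i \<noteq> (0 :: 'f)} \<le> s k" if "k \<ge> 1" for k
  proof -
    have "card {i \<in> block k. unit_seq n i \<noteq> (0 :: 'f)} \<le> card {n}"
      by (rule card_mono) (auto simp: unit_seq_def)
    then show ?thesis using s_pos[OF that] by simp
  qed
  then show "unit_seq n \<in> F" by (auto simp: F_def unit_seq_def)
qed

lemma ns_le_iff: "i \<ge> 1 \<Longrightarrow> j \<ge> 1 \<Longrightarrow> ns i \<le> ns j \<longleftrightarrow> i \<le> j"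
  using strict_mono_on_less_eq[OF ns_mono] by auto

lemma ns_eq_iff: "i \<ge> 1 \<Longrightarrow> j \<ge> 1 \<Longrightarrow> ns i = ns j \<longleftrightarrow> i = j"
  using strict_mono_on_eqD[OF ns_mono] by auto

lemma inj_on_ns: "0 \<notin> S \<Longrightarrow> inj_on ns S"
  by (rule inj_onI) (metis ns_eq_iff One_nat_def Suc_le_eq not_gr_zero)

lemma s_le: "1 \<le> k \<Longrightarrow> k \<le> l \<Longrightarrow> s k \<le> s l"
  using strict_mono_on_leD[OF s_mono] by auto

lemma s_less_Suc: "1 \<le> k \<Longrightarrow> s k < s (Suc k)"
  using strict_mono_onD[OF s_mono, of k "Suc k"] by auto

lemma finite_block: "finite (block k)" and finite_half: "finite (half k)"
  by (auto simp: block_def half_def)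

lemma half_subset_block: "1 \<le> k \<Longrightarrow> half k \<subseteq> block k"
  using s_less_Suc[of k] by (auto simp: block_def half_def)

lemma block_subset: "block k \<subseteq> {1..}"
  by (auto simp: block_def Suc_le_eq intro!: ns_pos[unfolded One_nat_def Suc_le_eq])

lemma card_half: "card (half k) = (s (Suc k) - s k) div 2"
  unfolding half_def by (subst card_image) (auto intro: inj_on_ns)

lemma card_block: "card (block k) = s (Suc k) - s k"
  unfolding block_def by (subst card_image) (auto intro: inj_on_ns)

lemma block_disjoint:
  assumes "1 \<le> k" "k < l"
  shows "block k \<inter> block l = {}"
proof -
  have "s (Suc k) \<le> s l" using s_le[of "Suc k" l] assms by simp
  then show ?thesis
    by (auto simp: block_def ns_eq_iff)
qed

text \<open>
  This is why the restriction to a set that does not split any block is a contraction: pairing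
  with a restricted sequence is pairing with restricted coefficients.
\<close>
lemma restr_in_F:
  assumes "f \<in> F" and "\<And>k. k \<ge> 1 \<Longrightarrow> block k \<subseteq> E \<or> block k \<inter> E = {}"
  shows "restr E f \<in> F"
proof -
  have "card {i \<in> block k. restr E f i \<noteq> 0} \<le> s k \<or>
      (\<forall>i\<in>block k. restr E f i = (if i \<in> half k then 1 else 0))" if k: "k \<ge> 1" for k
  proof (cases "block k \<subseteq> E")
    case True
    then have "\<forall>i\<in>block k. restr E f i = f i" by (auto simp: restr_def)
    moreover from this have "{i \<in> block k. restr E f i \<noteq> 0} = {i \<in> block k. f i \<noteq> 0}" by auto
    ultimately show ?thesis using assms(1) k by (simp add: F_def)
  next
    case False
    then have "{i \<in> block k. restr E f i \<noteq> 0} = {}" using assms(2)[OF k] by (auto simp: restr_def)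
    then show ?thesis by (simp only: card.empty) simp
  qed
  moreover have "norm (restr E f i) \<le> 1" for i
    using norm_le_1[OF assms(1)] by (simp add: restr_def)
  ultimately show ?thesis by (simp add: F_def)
qed

lemma indicator_half_in_F:
  assumes "k \<ge> 1"
  shows "restr (half k) (\<lambda>_. 1) \<in> F"
proof -
  have "card {i \<in> block l. restr (half k) (\<lambda>_. 1 :: 'f) i \<noteq> 0} \<le> s l" if "l \<ge> 1" "l \<noteq> k" for l
  proof -
    have "block l \<inter> block k = {}"
      using block_disjoint[of k l] block_disjoint[of l k] assms that by (cases "k < l") auto
    then have "{i \<in> block l. restr (half k) (\<lambda>_. 1 :: 'f) i \<noteq> 0} = {}"
      using half_subset_block[OF assms] by (auto simp: restr_def)
    then show ?thesis by (simp only: card.empty)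
  qed
  moreover have "\<forall>i\<in>block k. restr (half k) (\<lambda>_. 1 :: 'f) i = (if i \<in> half k then 1 else 0)"
    by (simp add: restr_def)
  ultimately have "card {i \<in> block l. restr (half k) (\<lambda>_. 1 :: 'f) i \<noteq> 0} \<le> s l \<or>
      (\<forall>i\<in>block l. restr (half k) (\<lambda>_. 1 :: 'f) i = (if i \<in> half l then 1 else 0))" if "l \<ge> 1" for l
    using that by blast
  then show ?thesis
    by (simp add: F_def) (simp add: restr_def)
qed

text \<open>
  On a set that meets each block in few elements, the coefficients inverting the phases of \<open>x\<close> are
  admissible, so that there the norm is at least the \<open>\<ell>\<^sub>1\<close> norm.
\<close>
lemma sum_le_N:
  assumes x: "x \<in> V" and E: "finite E" "E \<subseteq> {1..}"
    and small: "\<And>k. k \<ge> 1 \<Longrightarrow> card (E \<inter> block k) \<le> s k"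
  shows "(\<Sum>i\<in>E. norm (x i)) \<le> N x"
proof -
  \<comment> \<open>Where \<open>x i = 0\<close>, the convention \<open>0 / 0 = 0\<close> gives an admissible coefficient.\<close>
  define f where "f = restr E (\<lambda>i. of_real (norm (x i)) / x i)"
  have fx: "f i * x i = of_real (norm (x i))" if "i \<in> E" for i
    using that by (simp add: f_def restr_def)
  have "norm (f i) \<le> 1" for i
    by (simp add: f_def restr_def norm_divide)
  moreover have "card {i \<in> block k. f i \<noteq> 0} \<le> s k" if "k \<ge> 1" for k
  proof (rule order_trans[OF card_mono small[OF that]])
    show "{i \<in> block k. f i \<noteq> 0} \<subseteq> E \<inter> block k"
      by (auto simp: f_def restr_def split: if_splits)
  qed (use E(1) in simp)
  ultimately have "f \<in> F" by (simp add: F_def)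
  obtain n where n: "E \<subseteq> {..n}" using finite_nat_iff_bounded_le E(1) by blast
  have "pairing f n x = (\<Sum>i\<in>E. f i * x i)"
    unfolding pairing_def
    by (rule sum.mono_neutral_right) (use n E in \<open>auto simp: f_def restr_def\<close>)
  also have "\<dots> = of_real (\<Sum>i\<in>E. norm (x i))"
    by (simp add: fx)
  finally have "norm (pairing f n x) = (\<Sum>i\<in>E. norm (x i))"
    by (simp del: of_real_sum add: sum_nonneg)
  then show ?thesis using pairing_le_N[OF x \<open>f \<in> F\<close>, of n] by simp
qed

lemma partial_sum_eq_restr:
  assumes "x \<in> V"
  shows "partial_sum ns m x = restr (ns ` {1..m}) x"
proof -
  have "partial_sum ns m x = (\<Sum>i\<in>ns ` {1..m}. coord_scale (es i x) (unit_seq i))"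
    unfolding partial_sum_def by (subst sum.reindex) (auto intro: inj_on_ns)
  then show ?thesis using assms by (simp add: es_def sum_unit_seq)
qed

lemma schauder_along_ns: "schauder_along ns"
proof -
  have "N (partial_sum ns m x) \<le> 1 * N x" if x: "x \<in> V" and "m \<ge> 1" for x m
  proof -
    \<comment> \<open>Restricting to the whole range of \<open>ns\<close> first splits no block; what remains is a truncation.\<close>
    have eq: "restr (ns ` {1..m}) x = restr {..ns m} (restr (ns ` {1..}) x)"
      using \<open>m \<ge> 1\<close> by (auto simp: restr_def fun_eq_iff ns_le_iff image_iff)
    have F: "restr (ns ` {1..}) f \<in> F" if "f \<in> F" for f
      by (rule restr_in_F[OF that]) (auto simp: block_def)
    show ?thesis
      unfolding partial_sum_eq_restr[OF x] eq mult_1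
    proof (rule N_le)
      fix f n assume "f \<in> F"
      then show "norm (pairing f n (restr {..ns m} (restr (ns ` {1..}) x))) \<le> N x"
        unfolding pairing_restr_atMost by (subst pairing_restr) (intro pairing_le_N x F)
    qed
  qed
  then show ?thesis unfolding schauder_along_def by (intro exI[of _ 1]) simp
qed

section \<open>Greedy remainders\<close>

text \<open>
  With \<open>Q\<close> the first \<open>s K\<close> terms of \<open>ns\<close> and \<open>y\<close> the vector \<open>x\<close> minus its partial sum along \<open>ns\<close>,
  the greedy remainder equals the part of \<open>y\<close> outside \<open>Q\<close>, minus
  the part of \<open>y\<close> on \<open>A - Q\<close>, plus the part of \<open>x\<close> on \<open>Q - A\<close>. The first part is controlled since \<open>Q\<close>
  splits no block, the second since \<open>A - Q\<close> has at most \<open>s k\<close> elements in the \<open>k\<close>-th block, and the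
  third by comparison with the second, coefficient by coefficient, as \<open>A\<close> is greedy and has as
  many elements as \<open>Q\<close>.
\<close>
lemma N_greedy_remainder_le:
  assumes x: "x \<in> V" and K: "K \<ge> 1" and greedy: "greedy_set x (s K) A" and j: "j \<le> s K"
  shows "N (x - proj A x) \<le> 3 * N (x - partial_sum ns j x)"
proof -
  define Q where "Q = ns ` {1..s K}"
  define y where "y = x - restr (ns ` {1..j}) x"
  have A: "finite A" "A \<subseteq> {1..}" "card A = s K"
    and greedy_le: "\<forall>a\<in>A. \<forall>b\<in>{1..} - A. norm (x a) \<ge> norm (x b)"
    using greedy x unfolding greedy_set_def es_def by auto
  have Q: "finite Q" "Q \<subseteq> {1..}" "card Q = s K"
    unfolding Q_def using ns_pos card_image[OF inj_on_ns, of "{1..s K}"] by (auto simp: image_subset_iff)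
  have "0 \<notin> ns ` {1..j}" using ns_pos by force
  then have y: "y \<in> V"
    unfolding y_def by (intro subspace_diff[OF subspace_V] x finite_support_in_V) auto
  have y_eq: "y i = x i" if "i \<notin> Q" for i
    using that j by (auto simp: y_def restr_def Q_def)
  have block_Q: "if k < K then block k \<subseteq> Q else block k \<inter> Q = {}" if "k \<ge> 1" for k
  proof (cases "k < K")
    case True
    then have "s (Suc k) \<le> s K" using s_le[of "Suc k" K] by simp
    then show ?thesis using True by (auto simp: block_def Q_def)
  next
    case False
    then have "s K \<le> s k" using s_le[of K k] K by simp
    then show ?thesis using False by (auto simp: block_def Q_def ns_eq_iff)
  qed
  have finV: "restr E z \<in> V" if "finite E" "E \<subseteq> {1..}" for E z
    using that by (intro finite_support_in_V) auto
  have "restr (- Q) y = y - restr Q y" by (auto simp: restr_def fun_eq_iff)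
  then have mV: "restr (- Q) y \<in> V"
    using subspace_diff[OF subspace_V y finV[OF Q(1,2), of y]] by simp
  have "restr (- Q) f \<in> F" if "f \<in> F" for f
    by (rule restr_in_F[OF that]) (use block_Q in \<open>force split: if_splits\<close>)
  then have 1: "N (restr (- Q) y) \<le> N y"
    by (intro N_le) (simp add: pairing_restr pairing_le_N[OF y])
  have "card ((A - Q) \<inter> block k) \<le> s k" if "k \<ge> 1" for k
  proof (cases "k < K")
    case True
    then have "(A - Q) \<inter> block k = {}" using block_Q[OF that] by auto
    then show ?thesis by simp
  next
    case False
    have "card ((A - Q) \<inter> block k) \<le> card A" by (rule card_mono) (use A in auto)
    then show ?thesis using s_le[of K k] K False A(3) by simp
  qed
  then have sum_y: "(\<Sum>i\<in>A - Q. norm (y i)) \<le> N y"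
    by (intro sum_le_N[OF y]) (use A in auto)
  then have 2: "N (restr (A - Q) y) \<le> N y"
    using N_restr_le_sum[of "A - Q" y] A(1) by simp
  have "card (Q - A) = card (A - Q)"
    using card_Diff_subset_Int[of Q A] card_Diff_subset_Int[of A Q] A Q by (simp add: Int_commute)
  then obtain h where h: "bij_betw h (Q - A) (A - Q)"
    using finite_same_card_bij[of "Q - A" "A - Q"] A(1) Q(1) by auto
  have "(\<Sum>i\<in>Q - A. norm (x i)) \<le> (\<Sum>i\<in>Q - A. norm (x (h i)))"
    by (rule sum_mono) (use bij_betwE[OF h] Q(2) in \<open>auto intro!: greedy_le[rule_format]\<close>)
  also have "\<dots> = (\<Sum>i\<in>A - Q. norm (x i))" by (rule sum.reindex_bij_betw[OF h])
  also have "\<dots> = (\<Sum>i\<in>A - Q. norm (y i))" using y_eq by simp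
  finally have 3: "N (restr (Q - A) x) \<le> N y"
    using N_restr_le_sum[of "Q - A" x] Q(1) sum_y by simp
  have "proj A x = restr A x" by (rule proj_eq_restr[OF x A(1)])
  then have "x - proj A x = restr (- Q) y - restr (A - Q) y + restr (Q - A) x"
    using y_eq by (auto simp: restr_def fun_eq_iff)
  also have "\<dots> = restr (- Q) y + (coord_scale (- 1) (restr (A - Q) y) + restr (Q - A) x)"
    by (auto simp: coord_scale_def fun_eq_iff)
  finally have "N (x - proj A x) \<le> N (restr (- Q) y) + (N (coord_scale (- 1) (restr (A - Q) y)) + N (restr (Q - A) x))"
    using N_triangle[OF mV subspace_add[OF subspace_V subspace_scale[OF subspace_V finV] finV], of "A - Q" "Q - A" "- 1" y x]
      N_triangle[OF subspace_scale[OF subspace_V finV] finV, of "A - Q" "Q - A" "- 1" y x] A Q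
    by fastforce
  also have "N (coord_scale (- 1) (restr (A - Q) y)) = N (restr (A - Q) y)"
    using N_scale[OF finV, of "A - Q" "- 1" y] A by auto
  finally show ?thesis
    using 1 2 3 unfolding partial_sum_eq_restr[OF x] y_def[symmetric] by linarith
qed

lemma strong_partially_greedy_ns: "strong_partially_greedy s ns"
  unfolding strong_partially_greedy_def
proof (intro exI conjI ballI allI impI)
  fix x m A assume x: "x \<in> V" and m: "m \<in> s ` {1..}" and greedy: "greedy_set x m A"
  obtain K where K: "K \<ge> 1" "m = s K" using m by auto
  have "sigma_hat ns m x \<in> (\<lambda>k. N (x - partial_sum ns k x)) ` {0..m}"
    unfolding sigma_hat_def by (rule Min_in) auto
  then obtain j where "j \<le> m" "sigma_hat ns m x = N (x - partial_sum ns j x)" by auto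
  then show "N (x - proj A x) \<le> 3 * sigma_hat ns m x"
    using N_greedy_remainder_le[OF x K(1)] greedy K(2) by simp
qed simp

section \<open>Failure of conservativity and of quasi-greediness\<close>

text \<open>
  The first kind of admissible coefficients sees at most \<open>s k\<close> entries of a vector supported in the
  \<open>k\<close>-th block. For both vectors that refute the two properties, the second kind of coefficients
  contributes at most \<open>1\<close>, so that \<open>s k\<close> bounds their norms.
\<close>
lemma norm_pairing_restr_block_le:
  assumes "E \<subseteq> block k" "\<And>i. norm (x i) \<le> 1" "f \<in> F"
    and "card {i \<in> block k. f i \<noteq> 0} \<le> s k"
  shows "norm (pairing f n (restr E x)) \<le> s k"
proof -
  define E' where "E' = {i \<in> E. f i \<noteq> 0}"
  have E': "E' \<subseteq> {i \<in> block k. f i \<noteq> 0}" using assms(1) by (auto simp: E'_def)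
  then have fin: "finite E'" by (rule finite_subset) (simp add: finite_block)
  have "pairing f n (restr E x) = pairing f n (restr E' x)"
    unfolding pairing_def by (rule sum.cong) (auto simp: restr_def E'_def)
  also have "norm \<dots> \<le> (\<Sum>i\<in>E'. norm (x i))"
    by (rule norm_pairing_restr_le[OF norm_le_1[OF assms(3)] fin])
  also have "\<dots> \<le> (\<Sum>i\<in>E'. 1)" by (rule sum_mono) (rule assms(2))
  also have "\<dots> = real (card E')" by simp
  also have "\<dots> \<le> real (s k)"
    using card_mono[OF _ E'] finite_block assms(4) by force
  finally show ?thesis .
qed

lemma card_le_N_indicator:
  assumes "k \<ge> 1" "P \<subseteq> half k"
  shows "real (card P) \<le> N (restr P (\<lambda>_. 1))"
proof -
  have P: "finite P" "P \<subseteq> {1..}"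
    using assms half_subset_block[of k] block_subset[of k] finite_subset[OF _ finite_half] by auto
  obtain n where n: "P \<subseteq> {..n}" using finite_nat_iff_bounded_le P(1) by blast
  have "pairing (restr (half k) (\<lambda>_. 1 :: 'f)) n (restr P (\<lambda>_. 1)) = (\<Sum>i\<in>P. 1)"
    unfolding pairing_def
    by (rule sum.mono_neutral_cong_right) (use n P assms(2) in \<open>auto simp: restr_def\<close>)
  then have "norm (pairing (restr (half k) (\<lambda>_. 1 :: 'f)) n (restr P (\<lambda>_. 1))) = real (card P)"
    by simp
  then show ?thesis
    using pairing_le_N[OF finite_support_in_V indicator_half_in_F[OF assms(1)], of P n "\<lambda>_. 1"] P
    by force
qed

text \<open>
  The two halves of a block are compared. Coefficients of the second kind vanish on the second
  half, so only those of the first kind contribute to the norm of its indicator.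
\<close>
lemma not_conservative:
  assumes gap: "\<And>c::nat. \<exists>k\<ge>1. c * s k < s (Suc k)"
  shows "\<not> conservative ns"
proof
  assume "conservative ns"
  then obtain C where C: "C > 0"
    and bound: "\<And>A B. finite A \<Longrightarrow> finite B \<Longrightarrow> A \<subseteq> ns ` {1..} \<Longrightarrow> B \<subseteq> {1..} \<Longrightarrow> card A \<le> card B \<Longrightarrow>
      (\<And>a b. a \<in> A \<Longrightarrow> b \<in> B \<Longrightarrow> a < b) \<Longrightarrow> N (\<Sum>n\<in>A. unit_seq n) \<le> C * N (\<Sum>n\<in>B. unit_seq n)"
    unfolding conservative_def by (metis IntE)
  define c where "c = nat \<lceil>C\<rceil>"
  have c: "C \<le> real c" unfolding c_def by linarith
  \<comment> \<open>The first half of the block then has more than \<open>c * s k\<close> elements.\<close>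
  obtain k where k: "k \<ge> 1" and big: "(2 * c + 3) * s k < s (Suc k)" using gap by blast
  let ?A = "half k" and ?B = "block k - half k"
  have L: "(s (Suc k) - s k) div 2 > c * s k"
    using big s_pos[OF k] by (simp add: algebra_simps)
  have B1: "N (restr ?B (\<lambda>_. 1)) \<le> real (s k)"
  proof (rule N_le)
    fix f n assume f: "f \<in> F"
    show "norm (pairing f n (restr ?B (\<lambda>_. 1))) \<le> real (s k)"
    proof (cases "card {i \<in> block k. f i \<noteq> 0} \<le> s k")
      case True
      then show ?thesis by (intro norm_pairing_restr_block_le f) auto
    next
      case False
      then have "\<forall>i\<in>block k. f i = (if i \<in> half k then 1 else 0)"
        using f k unfolding F_def by blast
      then have "\<forall>i\<in>?B. f i = 0" by simp
      then have "pairing f n (restr ?B (\<lambda>_. 1)) = 0"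
        unfolding pairing_def by (intro sum.neutral) (auto simp: restr_def)
      then show ?thesis by simp
    qed
  qed
  have "card ?B = s (Suc k) - s k - (s (Suc k) - s k) div 2"
    using card_Diff_subset[OF finite_half half_subset_block[OF k]] by (simp add: card_half card_block)
  then have "card ?A \<le> card ?B" unfolding card_half by linarith
  moreover have "a < b" if ab: "a \<in> ?A" "b \<in> ?B" for a b
  proof -
    obtain p q where p: "a = ns p" "s k < p" "p \<le> s k + (s (Suc k) - s k) div 2"
      and q: "b = ns q" "s k < q"
      using ab by (auto simp: half_def block_def)
    have "q > s k + (s (Suc k) - s k) div 2" using ab q by (auto simp: half_def)
    then show ?thesis using strict_mono_onD[OF ns_mono, of p q] p q by auto
  qed
  moreover have "half k \<subseteq> ns ` {1..}" "?B \<subseteq> {1..}"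
    using block_subset[of k] by (auto simp: half_def)
  ultimately have "N (\<Sum>n\<in>?A. unit_seq n) \<le> C * N (\<Sum>n\<in>?B. unit_seq n)"
    using finite_half finite_Diff[OF finite_block] by (intro bound)
  then have "real (card ?A) \<le> C * real (s k)"
    using card_le_N_indicator[OF k order_refl] mult_left_mono[OF B1 less_imp_le[OF C]]
    by (simp add: sum_unit_seq_1 finite_half finite_block)
  also have "\<dots> \<le> real c * real (s k)" using c by (simp add: mult_right_mono)
  also have "\<dots> = real (c * s k)" by simp
  finally show False using L unfolding card_half of_nat_le_iff by simp
qed

text \<open>
  All nonzero coefficients of the vector with alternating signs on the first half have modulus
  \<open>1\<close>, so its positive part is a greedy projection. Its norm is the number of its terms, while
  in the whole vector the signs cancel in every partial sum over the first half.
\<close>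
lemma not_quasi_greedy:
  assumes gap: "\<And>c::nat. \<exists>k\<ge>1. c * s k < s (Suc k)"
  shows "\<not> quasi_greedy"
proof
  assume "quasi_greedy"
  then obtain C where C: "C > 0"
    and bound: "\<And>x m A. x \<in> V \<Longrightarrow> m \<ge> 1 \<Longrightarrow> greedy_set x m A \<Longrightarrow> N (proj A x) \<le> C * N x"
    unfolding quasi_greedy_def by blast
  define c where "c = nat \<lceil>C\<rceil>"
  have c: "C \<le> real c" unfolding c_def by linarith
  \<comment> \<open>Only every other position of the first half carries the sign \<open>+\<close>, hence about a quarter of the block.\<close>
  obtain k where k: "k \<ge> 1" and big: "(4 * c + 5) * s k < s (Suc k)" using gap by blast
  define L where "L = (s (Suc k) - s k) div 2"
  have "(s (Suc k) - s k) \<ge> 4 * (c * s k + s k)"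
    using big by (simp add: algebra_simps)
  moreover have "c * s k + s k > c * s k" using s_pos[OF k] by simp
  moreover have "L div 2 = (s (Suc k) - s k) div 4"
    by (simp add: L_def flip: div_mult2_eq)
  moreover have "(s (Suc k) - s k) div 4 \<ge> c * s k + s k"
    using div_le_mono[OF calculation(1), of 4] by simp
  ultimately have L: "L div 2 > c * s k"
    by linarith
  define \<epsilon> :: "nat \<Rightarrow> 'f" where "\<epsilon> i = (- 1) ^ inv_into {1..} ns i" for i
  have \<epsilon>_ns: "\<epsilon> (ns p) = (- 1) ^ p" if "p \<ge> 1" for p
    unfolding \<epsilon>_def using that by (subst inv_into_f_f) (auto intro: inj_on_ns)
  have norm_\<epsilon>: "norm (\<epsilon> i) = 1" for i by (simp add: \<epsilon>_def norm_power)
  define x where "x = restr (half k) \<epsilon>"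
  define P where "P = ns ` {p \<in> {s k<..s k + L}. even p}"
  have half_k: "half k = ns ` {s k<..s k + L}" by (simp add: half_def L_def)
  have P_half: "P \<subseteq> half k" by (auto simp: P_def half_k)
  have half_pos: "half k \<subseteq> {1..}" using half_subset_block[OF k] block_subset[of k] by blast
  have x: "x \<in> V" unfolding x_def using half_pos finite_half by (intro finite_support_in_V) auto
  have "N x \<le> real (s k)"
  proof (rule N_le)
    fix f n assume f: "f \<in> F"
    show "norm (pairing f n x) \<le> real (s k)"
    proof (cases "card {i \<in> block k. f i \<noteq> 0} \<le> s k")
      case True
      then show ?thesis
        unfolding x_def by (intro norm_pairing_restr_block_le f half_subset_block[OF k]) (auto simp: norm_\<epsilon>)
    next
      case False
      then have "\<forall>i\<in>block k. f i = (if i \<in> half k then 1 else 0)"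
        using f k unfolding F_def by blast
      then have f1: "f i = 1" if "i \<in> half k" for i
        using that half_subset_block[OF k] by auto
      have "pairing f n x = (\<Sum>i\<in>{i \<in> half k. i \<le> n}. \<epsilon> i)"
        unfolding pairing_def x_def
        by (rule sum.mono_neutral_cong_right) (use half_pos in \<open>auto simp: restr_def f1\<close>)
      also have "{i \<in> half k. i \<le> n} = ns ` {p. p \<in> {s k<..s k + L} \<and> ns p \<le> n}"
        by (auto simp: half_k)
      also have "(\<Sum>i\<in>\<dots>. \<epsilon> i) = (\<Sum>p | p \<in> {s k<..s k + L} \<and> ns p \<le> n. (- 1) ^ p)"
        by (subst sum.reindex) (auto intro!: inj_on_ns sum.cong simp: \<epsilon>_ns)
      also have "norm \<dots> \<le> 1"
        by (rule norm_sum_alternating_le_1) (rule monotone_on_subset[OF ns_mono], auto)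
      finally show ?thesis using s_pos[OF k] by simp
    qed
  qed
  moreover have cardP: "card P \<ge> L div 2"
    unfolding P_def using card_even_greaterThanAtMost[of L "s k"]
    by (subst card_image) (auto intro: inj_on_ns)
  moreover have "greedy_set x (card P) P"
    unfolding greedy_set_def
    using P_half half_pos finite_subset[OF P_half finite_half] x
    by (auto simp: es_def x_def restr_def norm_\<epsilon>)
  then have "N (proj P x) \<le> C * N x"
    using cardP L by (intro bound x) auto
  moreover have "proj P x = restr P (\<lambda>_. 1)"
  proof -
    have "proj P x = restr P x" using proj_eq_restr[OF x] finite_subset[OF P_half finite_half] by simp
    also have "\<dots> = restr P (\<lambda>_. 1)"
      using P_half by (auto simp: restr_def fun_eq_iff x_def) (auto simp: P_def \<epsilon>_ns)
    finally show ?thesis .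
  qed
  ultimately have "real (L div 2) \<le> C * real (s k)"
    using card_le_N_indicator[OF k P_half] mult_left_mono[OF \<open>N x \<le> real (s k)\<close> less_imp_le[OF C]] by simp
  also have "\<dots> \<le> real c * real (s k)" using c by (simp add: mult_right_mono)
  also have "\<dots> = real (c * s k)" by simp
  finally show False using L unfolding of_nat_le_iff by simp
qed

end

theorem proposition7p20:
  fixes ns s :: "nat \<Rightarrow> nat"
  assumes "strict_mono_on {1..} ns" and "\<And>k. k \<ge> 1 \<Longrightarrow> ns k \<ge> 1"
    and "strict_mono_on {1..} s" and "\<And>k. k \<ge> 1 \<Longrightarrow> s k \<ge> 1"
    and "(SUP k\<in>{1..}. ereal (real (s (Suc k)) / real (s k))) = \<infinity>"
  shows "\<exists>(V :: (nat \<Rightarrow> 'f::{real_normed_field,euclidean_space}) set) N e es.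
    basis_on coord_scale V N e es \<and>
    basis_on.schauder coord_scale V N e es \<and>
    basis_on.schauder_along coord_scale V N e es ns \<and>
    basis_on.strong_partially_greedy coord_scale V N e es s ns \<and>
    \<not> basis_on.conservative N e ns \<and>
    \<not> basis_on.quasi_greedy coord_scale V N e es"
proof -
  have gap: "\<exists>k\<ge>1. c * s k < s (Suc k)" for c :: nat
  proof -
    have "ereal (real c) < (SUP k\<in>{1..}. ereal (real (s (Suc k)) / real (s k)))"
      using assms(5) by simp
    then obtain k where k: "k \<ge> 1" "real c < real (s (Suc k)) / real (s k)"
      by (auto simp: less_SUP_iff)
    then have "real c * real (s k) < real (s (Suc k))"
      using assms(4)[of k] by (simp add: field_simps)
    then have "c * s k < s (Suc k)" by (metis of_nat_less_iff of_nat_mult)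
    then show ?thesis using k(1) by blast
  qed
  define block where "block = (\<lambda>k. ns ` {s k<..s (Suc k)})"
  define half where "half = (\<lambda>k. ns ` {s k<..s k + (s (Suc k) - s k) div 2})"
  define F :: "(nat \<Rightarrow> 'f) set" where "F = {f. (\<forall>i. norm (f i) \<le> 1) \<and>
      (\<forall>k\<ge>1. card {i \<in> block k. f i \<noteq> 0} \<le> s k \<or>
        (\<forall>i\<in>block k. f i = (if i \<in> half k then 1 else 0)))}"
  interpret gap_family ns s F block half
    by unfold_locales (use assms(1-4) in \<open>auto simp: block_def half_def F_def\<close>)
  show ?thesis
    using basis_on_axioms schauder schauder_along_ns strong_partially_greedy_ns
      not_conservative[OF gap] not_quasi_greedy[OF gap] by blast
qed

end
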